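(* Let $(M,I,J,K,g_M)$ be a hyperkähler manifold, $(N,g_N)$ a Riemannian manifold, and $F:(M,g_M)\to(N,g_N)$ a h-Lagrangian submersion such that $(I,J,K)$ is a h-Lagrangian basis, i.e. $F$ is a Riemannian submersion with $I(\ker F_* )=(\ker F_* )^{\perp}$, $J(\ker F_* )=\ker F_*$ and $K(\ker F_* )=(\ker F_* )^{\perp}$. Then the following conditions are equivalent: a) the distribution $\ker F_*$ defines a totally geodesic foliation on $M$; b) $\mathcal{T}_V IX=0$ for all $X\in\Gamma((\ker F_* )^{\perp})$ and $V\in\Gamma(\ker F_* )$; c) $\mathcal{T}_V KX=0$ for all $X\in\Gamma((\ker F_* )^{\perp})$ and $V\in\Gamma(\ker F_* )$; d) $\mathcal{T}_V JX=0$ for all $X\in\Gamma((\ker F_* )^{\perp})$ and $V\in\Gamma(\ker F_* )$.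
   Context: A hyperkähler manifold $(M,I,J,K,g_M)$ is a $4m$-dimensional Riemannian manifold with endomorphism fields $I,J,K$ of $TM$ satisfying $I^2=J^2=K^2=-\mathrm{id}$, $IJ=-JI=K$, $JK=-KJ=I$, $KI=-IK=J$, $g_M(RX,RY)=g_M(X,Y)$ for $R\in\{I,J,K\}$, and $\nabla I=\nabla J=\nabla K=0$, where $\nabla$ is the Levi-Civita connection of $g_M$. A Riemannian submersion $F:(M,g_M)\to(N,g_N)$ is a smooth surjective submersion such that $(F_* )_p:(\ker (F_* )_p)^{\perp}\to T_{F(p)}N$ is a linear isometry for every $p\in M$. For a vector field $U$ on $M$ write $U=\mathcal{V}U+\mathcal{H}U$ with $\mathcal{V}U\in\Gamma(\ker F_* )$ and $\mathcal{H}U\in\Gamma((\ker F_* )^{\perp})$. The O'Neill tensor $\mathcal{T}$ is $$\mathcal{T}_U W=\mathcal{H}\nabla_{\mathcal{V}U}\mathcal{V}W+\mathcal{V}\nabla_{\mathcal{V}U}\mathcal{H}W .$$ A distribution $\xi\subset TM$ defines a totally geodesic foliation if $\nabla_XY\in\Gamma(\xi)$ for all $X,Y\in\Gamma(\xi)$ (this implies integrability). *)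

theory Defs
  imports "HOL-Analysis.Analysis" "HOL-Library.Function_Algebras"
begin

text \<open>Functions into a real vector space form a real vector space under the pointwise
  operations (the additive part is in \<^theory>\<open>HOL-Library.Function_Algebras\<close>).  It is used for
  smooth functions, for derivations and for vector fields alike.\<close>

instantiation "fun" :: (type, real_vector) real_vector
begin

definition scaleR_fun :: "real \<Rightarrow> ('a \<Rightarrow> 'b) \<Rightarrow> 'a \<Rightarrow> 'b"
  where "scaleR_fun c f = (\<lambda>x. c *\<^sub>R f x)"

instance
  by standard (simp_all add: scaleR_fun_def fun_eq_iff scaleR_add_right scaleR_add_left)

end

text \<open>Maps of class \<open>C\<^sup>k\<close>; meant for open \<open>S\<close>.\<close>

fun Ck_on :: "nat \<Rightarrow> 'a::real_normed_vector set \<Rightarrow> ('a \<Rightarrow> 'b::real_normed_vector) \<Rightarrow> bool"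
  where
    "Ck_on 0 S f \<longleftrightarrow> continuous_on S f"
  | "Ck_on (Suc k) S f \<longleftrightarrow> (\<forall>x\<in>S. f differentiable (at x)) \<and>
       (\<forall>v. Ck_on k S (\<lambda>x. frechet_derivative f (at x) v))"

definition smooth_on :: "'a::real_normed_vector set \<Rightarrow> ('a \<Rightarrow> 'b::real_normed_vector) \<Rightarrow> bool"
  where "smooth_on S f \<longleftrightarrow> (\<forall>k. Ck_on k S f)"

text \<open>The underlying set of a manifold is the universe of a type \<open>'m\<close>, which carries the
  topology; Hausdorff and second countable are class constraints.  The smooth structure is
  given by an atlas, not necessarily maximal, with values in the Euclidean space \<open>'e\<close>, so the
  dimension is \<open>DIM('e)\<close>.  A chart is a pair of a domain \<open>U\<close> and a map \<open>\<phi>\<close> which is relevant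
  on \<open>U\<close> only; its inverse is \<open>inv_into U \<phi>\<close>.\<close>

type_synonym ('m, 'e) atlas = "('m set \<times> ('m \<Rightarrow> 'e)) set"

definition smooth_manifold ::
  "('m::{t2_space,second_countable_topology}, 'e::euclidean_space) atlas \<Rightarrow> bool"
  where "smooth_manifold A \<longleftrightarrow>
    (\<Union>(U, \<phi>)\<in>A. U) = UNIV \<and>
    (\<forall>(U, \<phi>)\<in>A. open U \<and> open (\<phi> ` U) \<and> homeomorphism U (\<phi> ` U) \<phi> (inv_into U \<phi>)) \<and>
    (\<forall>(U, \<phi>)\<in>A. \<forall>(V, \<psi>)\<in>A. smooth_on (\<phi> ` (U \<inter> V)) (\<psi> \<circ> inv_into U \<phi>))"

definition smooth_functions :: "('m, 'e::euclidean_space) atlas \<Rightarrow> ('m \<Rightarrow> real) set"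
  where "smooth_functions A = {f. \<forall>(U, \<phi>)\<in>A. smooth_on (\<phi> ` U) (f \<circ> inv_into U \<phi>)}"

definition smooth_map :: "('m::topological_space, 'e::euclidean_space) atlas \<Rightarrow>
    ('n::topological_space, 'f::euclidean_space) atlas \<Rightarrow> ('m \<Rightarrow> 'n) \<Rightarrow> bool"
  where "smooth_map A B F \<longleftrightarrow> continuous_on UNIV F \<and>
    (\<forall>(U, \<phi>)\<in>A. \<forall>(V, \<psi>)\<in>B. smooth_on (\<phi> ` (U \<inter> F -` V)) (\<psi> \<circ> F \<circ> inv_into U \<phi>))"

text \<open>Tangent vectors at \<open>p\<close> are the derivations at \<open>p\<close> of the algebra of smooth functions.
  Setting them to 0 on functions that are not smooth makes equality of tangent vectors
  coincide with equality in HOL.  Metrics and endomorphism fields are only relevant at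
  arguments in \<open>tangent_space A p\<close>.\<close>

type_synonym 'm tangent_vector = "('m \<Rightarrow> real) \<Rightarrow> real"
type_synonym 'm vector_field = "'m \<Rightarrow> 'm tangent_vector"
type_synonym 'm distribution = "'m \<Rightarrow> 'm tangent_vector set"
type_synonym 'm tensor_field2 = "'m \<Rightarrow> 'm tangent_vector \<Rightarrow> 'm tangent_vector \<Rightarrow> real"
type_synonym 'm endo_field = "'m \<Rightarrow> 'm tangent_vector \<Rightarrow> 'm tangent_vector"
type_synonym 'm connection = "'m vector_field \<Rightarrow> 'm vector_field \<Rightarrow> 'm vector_field"

definition tangent_space :: "('m, 'e::euclidean_space) atlas \<Rightarrow> 'm distribution"
  where "tangent_space A p = {v.
    (\<forall>f\<in>smooth_functions A. \<forall>h\<in>smooth_functions A. v (f + h) = v f + v h) \<and>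
    (\<forall>c. \<forall>f\<in>smooth_functions A. v (c *\<^sub>R f) = c * v f) \<and>
    (\<forall>f\<in>smooth_functions A. \<forall>h\<in>smooth_functions A. v (f * h) = v f * h p + f p * v h) \<and>
    (\<forall>f. f \<notin> smooth_functions A \<longrightarrow> v f = 0)}"

definition deriv_along :: "'m vector_field \<Rightarrow> ('m \<Rightarrow> real) \<Rightarrow> 'm \<Rightarrow> real"
  where "deriv_along X f = (\<lambda>p. X p f)"

definition vector_fields :: "('m, 'e::euclidean_space) atlas \<Rightarrow> 'm vector_field set"
  where "vector_fields A = {X. (\<forall>p. X p \<in> tangent_space A p) \<and>
    (\<forall>f\<in>smooth_functions A. deriv_along X f \<in> smooth_functions A)}"

definition sections ::
  "('m, 'e::euclidean_space) atlas \<Rightarrow> 'm distribution \<Rightarrow> 'm vector_field set"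
  where "sections A \<xi> = {X \<in> vector_fields A. \<forall>p. X p \<in> \<xi> p}"

definition fun_scale :: "('m \<Rightarrow> real) \<Rightarrow> 'm vector_field \<Rightarrow> 'm vector_field"
  where "fun_scale f X = (\<lambda>p. f p *\<^sub>R X p)"

definition lie_bracket :: "'m vector_field \<Rightarrow> 'm vector_field \<Rightarrow> 'm vector_field"
  where "lie_bracket X Y = (\<lambda>p f. X p (deriv_along Y f) - Y p (deriv_along X f))"

definition endo_apply :: "'m endo_field \<Rightarrow> 'm vector_field \<Rightarrow> 'm vector_field"
  where "endo_apply R X = (\<lambda>p. R p (X p))"

definition smooth_endo_field :: "('m, 'e::euclidean_space) atlas \<Rightarrow> 'm endo_field \<Rightarrow> bool"
  where "smooth_endo_field A R \<longleftrightarrow>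
    (\<forall>p. R p ` tangent_space A p \<subseteq> tangent_space A p \<and>
      (\<forall>u\<in>tangent_space A p. \<forall>v\<in>tangent_space A p. R p (u + v) = R p u + R p v) \<and>
      (\<forall>c. \<forall>v\<in>tangent_space A p. R p (c *\<^sub>R v) = c *\<^sub>R R p v)) \<and>
    (\<forall>X\<in>vector_fields A. endo_apply R X \<in> vector_fields A)"

text \<open>The push-forward of a derivation does not depend on its base point.\<close>

definition differential :: "('n, 'f::euclidean_space) atlas \<Rightarrow> ('m \<Rightarrow> 'n) \<Rightarrow>
    'm tangent_vector \<Rightarrow> 'n tangent_vector"
  where "differential B F v = (\<lambda>h. if h \<in> smooth_functions B then v (h \<circ> F) else 0)"

definition ker_diff :: "('m, 'e::euclidean_space) atlas \<Rightarrow> ('n, 'f::euclidean_space) atlas \<Rightarrow>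
    ('m \<Rightarrow> 'n) \<Rightarrow> 'm distribution"
  where "ker_diff A B F p = {v \<in> tangent_space A p. differential B F v = 0}"

definition pair_fields ::
  "'m tensor_field2 \<Rightarrow> 'm vector_field \<Rightarrow> 'm vector_field \<Rightarrow> 'm \<Rightarrow> real"
  where "pair_fields g X Y = (\<lambda>p. g p (X p) (Y p))"

definition riemannian_metric :: "('m, 'e::euclidean_space) atlas \<Rightarrow> 'm tensor_field2 \<Rightarrow> bool"
  where "riemannian_metric A g \<longleftrightarrow>
    (\<forall>p. \<forall>u\<in>tangent_space A p. \<forall>v\<in>tangent_space A p.
      g p u v = g p v u \<and>
      (\<forall>w\<in>tangent_space A p. g p (u + v) w = g p u w + g p v w) \<and>
      (\<forall>c. g p (c *\<^sub>R u) v = c * g p u v) \<and>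
      (u \<noteq> 0 \<longrightarrow> g p u u > 0)) \<and>
    (\<forall>X\<in>vector_fields A. \<forall>Y\<in>vector_fields A. pair_fields g X Y \<in> smooth_functions A)"

definition riemannian_manifold ::
  "('m::{t2_space,second_countable_topology}, 'e::euclidean_space) atlas \<Rightarrow>
    'm tensor_field2 \<Rightarrow> bool"
  where "riemannian_manifold A g \<longleftrightarrow> smooth_manifold A \<and> riemannian_metric A g"

text \<open>\<open>D X Y\<close> is the covariant derivative of \<open>Y\<close> along \<open>X\<close>.  By the fundamental theorem of
  Riemannian geometry the following properties have a unique solution \<open>D\<close> on smooth vector
  fields; the values of \<open>D\<close> elsewhere are immaterial.\<close>

definition affine_connection :: "('m, 'e::euclidean_space) atlas \<Rightarrow> 'm connection \<Rightarrow> bool"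
  where "affine_connection A D \<longleftrightarrow>
    (\<forall>X\<in>vector_fields A. \<forall>Y\<in>vector_fields A.
      D X Y \<in> vector_fields A \<and>
      (\<forall>Z\<in>vector_fields A. D (X + Z) Y = D X Y + D Z Y \<and> D X (Y + Z) = D X Y + D X Z) \<and>
      (\<forall>f\<in>smooth_functions A.
        D (fun_scale f X) Y = fun_scale f (D X Y) \<and>
        D X (fun_scale f Y) = fun_scale (deriv_along X f) Y + fun_scale f (D X Y)))"

definition levi_civita ::
  "('m, 'e::euclidean_space) atlas \<Rightarrow> 'm tensor_field2 \<Rightarrow> 'm connection \<Rightarrow> bool"
  where "levi_civita A g D \<longleftrightarrow> affine_connection A D \<and>
    (\<forall>X\<in>vector_fields A. \<forall>Y\<in>vector_fields A. D X Y - D Y X = lie_bracket X Y) \<and>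
    (\<forall>X\<in>vector_fields A. \<forall>Y\<in>vector_fields A. \<forall>Z\<in>vector_fields A.
      deriv_along X (pair_fields g Y Z) = pair_fields g (D X Y) Z + pair_fields g Y (D X Z))"

definition parallel_endo ::
  "('m, 'e::euclidean_space) atlas \<Rightarrow> 'm connection \<Rightarrow> 'm endo_field \<Rightarrow> bool"
  where "parallel_endo A D R \<longleftrightarrow> (\<forall>X\<in>vector_fields A. \<forall>Y\<in>vector_fields A.
    D X (endo_apply R Y) - endo_apply R (D X Y) = 0)"

definition hyperkaehler_manifold ::
  "('m::{t2_space,second_countable_topology}, 'e::euclidean_space) atlas \<Rightarrow>
    'm endo_field \<Rightarrow> 'm endo_field \<Rightarrow> 'm endo_field \<Rightarrow>
    'm tensor_field2 \<Rightarrow> 'm connection \<Rightarrow> bool"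
  where "hyperkaehler_manifold A I J K g D \<longleftrightarrow>
    riemannian_manifold A g \<and> levi_civita A g D \<and> (\<exists>m::nat. DIM('e) = 4 * m) \<and>
    (\<forall>R\<in>{I, J, K}. smooth_endo_field A R \<and> parallel_endo A D R \<and>
      (\<forall>p. \<forall>u\<in>tangent_space A p. R p (R p u) = - u \<and>
        (\<forall>v\<in>tangent_space A p. g p (R p u) (R p v) = g p u v))) \<and>
    (\<forall>p. \<forall>u\<in>tangent_space A p.
      I p (J p u) = K p u \<and> J p (I p u) = - K p u \<and>
      J p (K p u) = I p u \<and> K p (J p u) = - I p u \<and>
      K p (I p u) = J p u \<and> I p (K p u) = - J p u)"

definition orth_distribution ::
  "('m, 'e::euclidean_space) atlas \<Rightarrow> 'm tensor_field2 \<Rightarrow> 'm distribution \<Rightarrow> 'm distribution"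
  where "orth_distribution A g \<xi> p = {u \<in> tangent_space A p. \<forall>v\<in>\<xi> p. g p u v = 0}"

definition totally_geodesic_foliation ::
  "('m, 'e::euclidean_space) atlas \<Rightarrow> 'm connection \<Rightarrow> 'm distribution \<Rightarrow> bool"
  where "totally_geodesic_foliation A D \<xi> \<longleftrightarrow>
    (\<forall>X\<in>sections A \<xi>. \<forall>Y\<in>sections A \<xi>. D X Y \<in> sections A \<xi>)"

text \<open>A linear isometry is meant as an isomorphism of inner product spaces, hence bijective;
  linearity of \<open>F\<^sub>*\<close> holds by construction.\<close>

definition riemannian_submersion ::
  "('m::topological_space, 'e::euclidean_space) atlas \<Rightarrow> 'm tensor_field2 \<Rightarrow>
    ('n::topological_space, 'f::euclidean_space) atlas \<Rightarrow> 'n tensor_field2 \<Rightarrow>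
    ('m \<Rightarrow> 'n) \<Rightarrow> bool"
  where "riemannian_submersion A g B g' F \<longleftrightarrow>
    smooth_map A B F \<and> surj F \<and>
    (\<forall>p. differential B F ` tangent_space A p = tangent_space B (F p)) \<and>
    (\<forall>p. let H = orth_distribution A g (ker_diff A B F) p in
      bij_betw (differential B F) H (tangent_space B (F p)) \<and>
      (\<forall>u\<in>H. \<forall>v\<in>H. g' (F p) (differential B F u) (differential B F v) = g p u v))"

definition ver :: "('m, 'e::euclidean_space) atlas \<Rightarrow> 'm tensor_field2 \<Rightarrow>
    ('n, 'f::euclidean_space) atlas \<Rightarrow> ('m \<Rightarrow> 'n) \<Rightarrow> 'm vector_field \<Rightarrow> 'm vector_field"
  where "ver A g B F U = (\<lambda>p. THE v. v \<in> ker_diff A B F p \<and>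
    U p - v \<in> orth_distribution A g (ker_diff A B F) p)"

definition hor :: "('m, 'e::euclidean_space) atlas \<Rightarrow> 'm tensor_field2 \<Rightarrow>
    ('n, 'f::euclidean_space) atlas \<Rightarrow> ('m \<Rightarrow> 'n) \<Rightarrow> 'm vector_field \<Rightarrow> 'm vector_field"
  where "hor A g B F U = U - ver A g B F U"

definition oneill_T :: "('m, 'e::euclidean_space) atlas \<Rightarrow> 'm tensor_field2 \<Rightarrow>
    ('n, 'f::euclidean_space) atlas \<Rightarrow> ('m \<Rightarrow> 'n) \<Rightarrow> 'm connection \<Rightarrow>
    'm vector_field \<Rightarrow> 'm vector_field \<Rightarrow> 'm vector_field"
  where "oneill_T A g B F D U W =
    hor A g B F (D (ver A g B F U) (ver A g B F W)) +
    ver A g B F (D (ver A g B F U) (hor A g B F W))"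

definition h_Lagrangian_submersion ::
  "('m::topological_space, 'e::euclidean_space) atlas \<Rightarrow> 'm tensor_field2 \<Rightarrow>
    'm endo_field \<Rightarrow> 'm endo_field \<Rightarrow> 'm endo_field \<Rightarrow>
    ('n::topological_space, 'f::euclidean_space) atlas \<Rightarrow> 'n tensor_field2 \<Rightarrow>
    ('m \<Rightarrow> 'n) \<Rightarrow> bool"
  where "h_Lagrangian_submersion A g I J K B g' F \<longleftrightarrow>
    riemannian_submersion A g B g' F \<and>
    (\<forall>p. I p ` ker_diff A B F p = orth_distribution A g (ker_diff A B F) p \<and>
         J p ` ker_diff A B F p = ker_diff A B F p \<and>
         K p ` ker_diff A B F p = orth_distribution A g (ker_diff A B F) p)"

end

theory Submission
  imports Defs
begin

text \<open>Write \<open>\<V> = ker F\<^sub>*\<close> and \<open>\<H>\<close> for its orthogonal complement.  For vertical \<open>V\<close>, \<open>W\<close> and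
  horizontal \<open>X\<close>, the tensor \<open>\<T>\<^sub>V W\<close> is the horizontal part of \<open>\<nabla>\<^sub>V W\<close> and \<open>\<T>\<^sub>V X\<close> is the
  vertical part of \<open>\<nabla>\<^sub>V X\<close>.  Since \<open>I\<close> and \<open>K\<close> exchange the sections of \<open>\<V>\<close> and \<open>\<H>\<close>, (b) and
  (c) both say that \<open>\<nabla>\<^sub>V W\<close> is always vertical, which is (a).  Since \<open>J\<close> permutes the sections
  of \<open>\<H>\<close>, (d) says that \<open>\<nabla>\<^sub>V X\<close> is always horizontal; writing \<open>X = I W\<close> and
  \<open>\<nabla>\<^sub>V (I W) = I \<nabla>\<^sub>V W\<close> turns this into (a) again.\<close>

section \<open>Tangent, vertical and horizontal spaces as linear subspaces\<close>

lemma tangent_space_zero: "0 \<in> tangent_space A p"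
  by (simp add: tangent_space_def)

lemma tangent_space_add:
  assumes "u \<in> tangent_space A p" "v \<in> tangent_space A p"
  shows "u + v \<in> tangent_space A p"
  using assms by (simp add: tangent_space_def algebra_simps)

lemma tangent_space_scaleR:
  assumes "u \<in> tangent_space A p"
  shows "c *\<^sub>R u \<in> tangent_space A p"
  using assms by (simp add: tangent_space_def scaleR_fun_def algebra_simps)

lemma subspace_tangent_space: "subspace (tangent_space A p)"
  by (intro subspaceI tangent_space_zero tangent_space_add tangent_space_scaleR)

lemma ker_diff_subset: "ker_diff A B F p \<subseteq> tangent_space A p"
  by (auto simp: ker_diff_def)

lemma differential_add: "differential B F (u + v) = differential B F u + differential B F v"
  by (simp add: differential_def fun_eq_iff)

lemma differential_scaleR: "differential B F (c *\<^sub>R u) = c *\<^sub>R differential B F u"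
  by (simp add: differential_def scaleR_fun_def fun_eq_iff)

lemma differential_diff: "differential B F (u - v) = differential B F u - differential B F v"
  by (simp add: differential_def fun_eq_iff)

lemma subspace_ker_diff: "subspace (ker_diff A B F p)"
proof (rule subspaceI)
  show "0 \<in> ker_diff A B F p"
    by (simp add: ker_diff_def tangent_space_zero differential_def fun_eq_iff)
qed (auto simp: ker_diff_def tangent_space_add tangent_space_scaleR
      differential_add differential_scaleR)

lemma riemannian_metric_zero_left:
  assumes "riemannian_metric A g" "v \<in> tangent_space A p"
  shows "g p 0 v = 0"
proof -
  have "g p (0 *\<^sub>R v) v = 0 * g p v v"
    using assms unfolding riemannian_metric_def by blast
  then show ?thesis
    by simp
qed

lemma orth_distribution_subset: "orth_distribution A g \<xi> p \<subseteq> tangent_space A p"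
  by (auto simp: orth_distribution_def)

lemma subspace_orth_distribution:
  assumes g: "riemannian_metric A g" and \<xi>: "\<xi> p \<subseteq> tangent_space A p"
  shows "subspace (orth_distribution A g \<xi> p)"
proof (rule subspaceI)
  show "0 \<in> orth_distribution A g \<xi> p"
    using riemannian_metric_zero_left[OF g] \<xi>
    by (auto simp: orth_distribution_def tangent_space_zero)
next
  fix u v assume uv: "u \<in> orth_distribution A g \<xi> p" "v \<in> orth_distribution A g \<xi> p"
  have "g p (u + v) w = 0" if "w \<in> \<xi> p" for w
  proof -
    have "g p (u + v) w = g p u w + g p v w"
      using g uv \<xi> that unfolding riemannian_metric_def orth_distribution_def by blast
    then show ?thesis
      using uv that by (simp add: orth_distribution_def)
  qed
  then show "u + v \<in> orth_distribution A g \<xi> p"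
    using uv by (simp add: orth_distribution_def tangent_space_add)
next
  fix c u assume u: "u \<in> orth_distribution A g \<xi> p"
  have "g p (c *\<^sub>R u) w = 0" if "w \<in> \<xi> p" for w
  proof -
    have "g p (c *\<^sub>R u) w = c * g p u w"
      using g u \<xi> that unfolding riemannian_metric_def orth_distribution_def by blast
    then show ?thesis
      using u that by (simp add: orth_distribution_def)
  qed
  then show "c *\<^sub>R u \<in> orth_distribution A g \<xi> p"
    using u by (simp add: orth_distribution_def tangent_space_scaleR)
qed

lemma subspace_orth_ker_diff:
  assumes "riemannian_metric A g"
  shows "subspace (orth_distribution A g (ker_diff A B F) p)"
  using assms ker_diff_subset by (rule subspace_orth_distribution)

text \<open>Such a vector is orthogonal to itself, and the metric is positive definite.\<close>

lemma orth_distribution_Int: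
  assumes "riemannian_metric A g" "u \<in> \<xi> p" "u \<in> orth_distribution A g \<xi> p"
  shows "u = 0"
proof (rule ccontr)
  assume "u \<noteq> 0"
  moreover have "u \<in> tangent_space A p" "g p u u = 0"
    using assms by (auto simp: orth_distribution_def)
  ultimately show False
    using assms(1) unfolding riemannian_metric_def by (metis less_irrefl)
qed

section \<open>Vertical and horizontal projections\<close>

text \<open>The differential already maps the horizontal space onto the tangent space of the base.
  The horizontal part of \<open>u\<close> is the lift \<open>h\<close> of its image, and
  \<open>u - h\<close> is vertical. The splitting thus comes from the submersion, not from a
  dimension count.\<close>

lemma riemannian_submersion_decomposition:
  assumes F: "riemannian_submersion A g B g' F" and u: "u \<in> tangent_space A p"
  obtains v where "v \<in> ker_diff A B F p" "u - v \<in> orth_distribution A g (ker_diff A B F) p"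
proof -
  let ?H = "orth_distribution A g (ker_diff A B F) p"
  have "differential B F ` ?H = differential B F ` tangent_space A p"
    using F unfolding riemannian_submersion_def Let_def bij_betw_def by blast
  then have "differential B F u \<in> differential B F ` ?H"
    using u by simp
  then obtain h where h: "h \<in> ?H" "differential B F u = differential B F h"
    by blast
  have "u - h \<in> tangent_space A p"
    using u subsetD[OF orth_distribution_subset h(1)]
    by (rule subspace_diff[OF subspace_tangent_space])
  then have "u - h \<in> ker_diff A B F p"
    using h(2) by (simp add: ker_diff_def differential_diff)
  moreover have "u - (u - h) \<in> ?H"
    using h(1) by simp
  ultimately show thesis
    by (rule that)
qed

text \<open>Discharges the definite description in \<open>ver\<close>: two candidates differ by a
  vector that is both vertical and horizontal.\<close>

lemma ver_eqI:
  assumes g: "riemannian_metric A g" and v: "v \<in> ker_diff A B F p"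
    and h: "U p - v \<in> orth_distribution A g (ker_diff A B F) p"
  shows "ver A g B F U p = v"
  unfolding ver_def
proof (rule the_equality)
  fix w assume w: "w \<in> ker_diff A B F p \<and> U p - w \<in> orth_distribution A g (ker_diff A B F) p"
  have "w - v \<in> ker_diff A B F p"
    using v w by (simp add: subspace_diff[OF subspace_ker_diff])
  \<comment> \<open>This difference is again \<open>w - v\<close>, now seen to be
    horizontal.\<close>
  moreover have "(U p - v) - (U p - w) \<in> orth_distribution A g (ker_diff A B F) p"
    using h w subspace_diff[OF subspace_orth_ker_diff[OF g]] by blast
  ultimately have "w - v = 0"
    by (intro orth_distribution_Int[OF g]) simp_all
  then show "w = v"
    by simp
qed (use v h in simp)

lemma ver_eq_self:
  assumes g: "riemannian_metric A g" and U: "\<And>p. U p \<in> ker_diff A B F p"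
  shows "ver A g B F U = U"
proof
  fix p
  have "U p - U p \<in> orth_distribution A g (ker_diff A B F) p"
    using subspace_0[OF subspace_orth_ker_diff[OF g]] by simp
  then show "ver A g B F U p = U p"
    by (rule ver_eqI[OF g U])
qed

lemma ver_eq_zero:
  assumes g: "riemannian_metric A g"
    and U: "\<And>p. U p \<in> orth_distribution A g (ker_diff A B F) p"
  shows "ver A g B F U = 0"
proof
  fix p show "ver A g B F U p = 0 p"
    using U by (auto intro: ver_eqI[OF g] subspace_0[OF subspace_ker_diff])
qed

lemma
  assumes g: "riemannian_metric A g" and F: "riemannian_submersion A g B g' F"
    and U: "U \<in> vector_fields A"
  shows hor_eq_zero_iff: "hor A g B F U = 0 \<longleftrightarrow> U \<in> sections A (ker_diff A B F)"
    and ver_eq_zero_iff: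
      "ver A g B F U = 0 \<longleftrightarrow> U \<in> sections A (orth_distribution A g (ker_diff A B F))"
proof -
  \<comment> \<open>The description in \<open>ver\<close> denotes here: existence comes from the
    submersion, uniqueness from \<open>ver_eqI\<close>.\<close>
  have ver: "ver A g B F U p \<in> ker_diff A B F p \<and>
      U p - ver A g B F U p \<in> orth_distribution A g (ker_diff A B F) p" for p
  proof -
    have "U p \<in> tangent_space A p"
      using U by (simp add: vector_fields_def)
    then obtain v where "v \<in> ker_diff A B F p"
        "U p - v \<in> orth_distribution A g (ker_diff A B F) p"
      by (rule riemannian_submersion_decomposition[OF F])
    then show ?thesis
      using ver_eqI[OF g] by metis
  qed
  show "hor A g B F U = 0 \<longleftrightarrow> U \<in> sections A (ker_diff A B F)"
  proof
    assume "hor A g B F U = 0"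
    then have "U = ver A g B F U"
      by (simp add: hor_def)
    then show "U \<in> sections A (ker_diff A B F)"
      using U ver by (simp add: sections_def)
  qed (auto simp: hor_def sections_def ver_eq_self[OF g])
  show "ver A g B F U = 0 \<longleftrightarrow> U \<in> sections A (orth_distribution A g (ker_diff A B F))"
  proof
    assume "ver A g B F U = 0"
    then have "ver A g B F U p = 0" for p
      by simp
    then show "U \<in> sections A (orth_distribution A g (ker_diff A B F))"
      using U ver by (simp add: sections_def)
  qed (auto simp: sections_def ver_eq_zero[OF g])
qed

section \<open>Vanishing of O'Neill's tensor\<close>

lemma Ck_on_zero: "Ck_on k S (\<lambda>_::'a::real_normed_vector. 0::'b::real_normed_vector)"
proof (induction k)
  case 0
  show ?case
    by (subst Ck_on.simps) (rule continuous_on_const)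
next
  case (Suc k)
  have "frechet_derivative (\<lambda>_::'a. 0::'b) (at x) v = 0" for x v
    by (subst frechet_derivative_const) (rule refl)
  then show ?case
    using Suc by (subst Ck_on.simps) (intro conjI ballI allI differentiable_const; simp only:)
qed

text \<open>Admits the zero field as an argument of the connection axioms, which speak of smooth
  fields only.\<close>

lemma zero_vector_field: "0 \<in> vector_fields A"
proof -
  have "deriv_along 0 f = (\<lambda>_. 0)" for f :: "'a \<Rightarrow> real"
    unfolding deriv_along_def zero_fun_apply ..
  moreover have "(\<lambda>_. 0) \<in> smooth_functions A"
    unfolding smooth_functions_def smooth_on_def comp_def using Ck_on_zero by blast
  ultimately show ?thesis
    by (auto simp only: vector_fields_def zero_fun_apply tangent_space_zero)
qed

lemma affine_connection_zero:
  assumes D: "affine_connection A D" and X: "X \<in> vector_fields A"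
  shows "D X 0 = 0"
proof -
  have "D X (0 + 0) = D X 0 + D X 0"
    using D X zero_vector_field unfolding affine_connection_def by blast
  then show ?thesis
    by simp
qed

text \<open>On a field of pure type one summand of the tensor contains \<open>D V 0\<close> and
  drops out. What remains is one projection of \<open>D V W\<close>, and its vanishing says that
  \<open>D V W\<close> lies in the complementary distribution, which has the same type as
  \<open>W\<close>.\<close>

lemma
  assumes g: "riemannian_metric A g" and F: "riemannian_submersion A g B g' F"
    and D: "affine_connection A D"
    and V: "V \<in> sections A (ker_diff A B F)"
  shows oneill_T_vertical_eq_zero_iff:
      "W \<in> sections A (ker_diff A B F) \<Longrightarrow>
        oneill_T A g B F D V W = 0 \<longleftrightarrow> D V W \<in> sections A (ker_diff A B F)"
    and oneill_T_horizontal_eq_zero_iff: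
      "W \<in> sections A (orth_distribution A g (ker_diff A B F)) \<Longrightarrow>
        oneill_T A g B F D V W = 0 \<longleftrightarrow>
          D V W \<in> sections A (orth_distribution A g (ker_diff A B F))"
proof -
  have V': "V \<in> vector_fields A" "ver A g B F V = V"
    using V by (auto simp: sections_def ver_eq_self[OF g])
  have DV: "D V W \<in> vector_fields A" if "W \<in> vector_fields A" for W
    using D V' that unfolding affine_connection_def by blast
  have zero: "ver A g B F 0 = 0" "hor A g B F 0 = 0"
  proof -
    show "ver A g B F 0 = 0"
      by (rule ver_eq_self[OF g]) (simp add: subspace_0[OF subspace_ker_diff])
    then show "hor A g B F 0 = 0"
      by (simp add: hor_def)
  qed
  show "oneill_T A g B F D V W = 0 \<longleftrightarrow> D V W \<in> sections A (ker_diff A B F)"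
    if W: "W \<in> sections A (ker_diff A B F)"
  proof -
    have W': "W \<in> vector_fields A" "ver A g B F W = W"
      using W by (auto simp: sections_def ver_eq_self[OF g])
    \<comment> \<open>Only \<open>hor\<close> at \<open>W\<close> is unfolded, giving
      \<open>W - W\<close>; the outer \<open>hor\<close> stays intact.\<close>
    then have "oneill_T A g B F D V W = hor A g B F (D V W)"
      by (simp add: oneill_T_def hor_def[of _ _ _ _ W] V' affine_connection_zero[OF D] zero)
    then show ?thesis
      using hor_eq_zero_iff[OF g F DV[OF W'(1)]] by simp
  qed
  show "oneill_T A g B F D V W = 0 \<longleftrightarrow>
      D V W \<in> sections A (orth_distribution A g (ker_diff A B F))"
    if W: "W \<in> sections A (orth_distribution A g (ker_diff A B F))"
  proof -
    have W': "W \<in> vector_fields A" "ver A g B F W = 0"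
      using W by (auto simp: sections_def ver_eq_zero[OF g])
    then have "oneill_T A g B F D V W = ver A g B F (D V W)"
      by (simp add: oneill_T_def hor_def[of _ _ _ _ W] V' affine_connection_zero[OF D] zero)
    then show ?thesis
      using ver_eq_zero_iff[OF g F DV[OF W'(1)]] by simp
  qed
qed

section \<open>Endomorphism fields with square minus the identity\<close>

text \<open>Since \<open>- R\<close> inverts \<open>R\<close>, and subspaces are closed under
  negation, \<open>R\<close> carries \<open>\<eta>\<close> back onto \<open>\<xi>\<close>. Keeping
  \<open>\<xi>\<close> and \<open>\<eta>\<close> arbitrary covers both the exchange of the two
  distributions by \<open>I\<close> and \<open>K\<close> and the case \<open>\<xi> = \<eta>\<close>
  needed for \<open>J\<close>.\<close>

lemma
  assumes R: "smooth_endo_field A R"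
    and square: "\<And>p u. u \<in> tangent_space A p \<Longrightarrow> R p (R p u) = - u"
    and \<xi>: "\<And>p. subspace (\<xi> p)" "\<And>p. \<xi> p \<subseteq> tangent_space A p"
    and image: "\<And>p. R p ` \<xi> p = \<eta> p"
  shows endo_image_swap: "R p ` \<eta> p = \<xi> p"
    and endo_apply_in_sections_iff:
      "X \<in> vector_fields A \<Longrightarrow> endo_apply R X \<in> sections A \<eta> \<longleftrightarrow> X \<in> sections A \<xi>"
    and endo_apply_image_sections: "endo_apply R ` sections A \<xi> = sections A \<eta>"
proof -
  have neg: "- u \<in> \<xi> p" if "u \<in> \<xi> p" for u p
    using \<xi>(1) that by (rule subspace_neg)
  have RR: "R p (R p u) = - u" if "u \<in> \<xi> p" for u p
    using square \<xi>(2) that by blast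
  have swap: "R p ` \<eta> p = \<xi> p" for p
  proof
    show "R p ` \<eta> p \<subseteq> \<xi> p"
      using neg RR by (auto simp flip: image)
    show "\<xi> p \<subseteq> R p ` \<eta> p"
    proof
      fix u assume "u \<in> \<xi> p"
      then have "u = R p (R p (- u))" "R p (- u) \<in> \<eta> p"
        using neg RR image by (force, blast)
      then show "u \<in> R p ` \<eta> p"
        by blast
    qed
  qed
  then show "R p ` \<eta> p = \<xi> p" .
  have iff: "R p u \<in> \<eta> p \<longleftrightarrow> u \<in> \<xi> p" if "u \<in> tangent_space A p" for p u
  proof
    assume "R p u \<in> \<eta> p"
    \<comment> \<open>Applying \<open>R\<close> once more sends \<open>R p u\<close> to
      \<open>- u\<close> and \<open>\<eta> p\<close> to \<open>\<xi> p\<close>.\<close>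
    then have "- u \<in> \<xi> p"
      using swap square[OF that] by force
    then show "u \<in> \<xi> p"
      using neg by force
  qed (use image in blast)
  have smooth: "endo_apply R X \<in> vector_fields A" if "X \<in> vector_fields A" for X
    using R that by (simp add: smooth_endo_field_def)
  show sections_iff: "endo_apply R X \<in> sections A \<eta> \<longleftrightarrow> X \<in> sections A \<xi>"
    if "X \<in> vector_fields A" for X
  proof -
    have "X p \<in> tangent_space A p" for p
      using that by (simp add: vector_fields_def)
    then show ?thesis
      using that smooth[OF that] iff by (simp add: sections_def endo_apply_def)
  qed
  show "endo_apply R ` sections A \<xi> = sections A \<eta>"
  proof
    show "endo_apply R ` sections A \<xi> \<subseteq> sections A \<eta>"
      using sections_iff by (auto simp: sections_def)
    show "sections A \<eta> \<subseteq> endo_apply R ` sections A \<xi>"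
    proof
      fix Y assume Y: "Y \<in> sections A \<eta>"
      \<comment> \<open>\<open>X = R\<^sup>3 Y = - R Y\<close>, but smoothness of \<open>R\<^sup>3 Y\<close> is immediate.\<close>
      define X where "X = endo_apply R (endo_apply R (endo_apply R Y))"
      have vf: "Y \<in> vector_fields A" "X \<in> vector_fields A"
        using Y smooth by (auto simp: sections_def X_def)
      have "endo_apply R X = Y"
      proof
        fix p
        have "Y p \<in> tangent_space A p" "endo_apply R (endo_apply R Y) p \<in> tangent_space A p"
          using vf(1) smooth by (auto simp: vector_fields_def)
        then show "endo_apply R X p = Y p"
          by (simp add: X_def endo_apply_def square)
      qed
      then show "Y \<in> endo_apply R ` sections A \<xi>"
        using sections_iff[OF vf(2)] Y by (metis imageI)
    qed
  qed
qed

section \<open>Quaternionic relations and the equivalence of the four conditions\<close>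

theorem lemma3p14:
  fixes A :: "('m::{t2_space,second_countable_topology}, 'e::euclidean_space) atlas"
    and B :: "('n::{t2_space,second_countable_topology}, 'f::euclidean_space) atlas"
    and gM :: "'m tensor_field2" and gN :: "'n tensor_field2"
    and I J K :: "'m endo_field" and D :: "'m connection" and F :: "'m \<Rightarrow> 'n"
  assumes "hyperkaehler_manifold A I J K gM D"
    and "riemannian_manifold B gN"
    and "h_Lagrangian_submersion A gM I J K B gN F"
  defines "Ver \<equiv> ker_diff A B F"
  defines "Hor \<equiv> orth_distribution A gM Ver"
  defines "T \<equiv> oneill_T A gM B F D"
  shows "(totally_geodesic_foliation A D Ver \<longleftrightarrow>
            (\<forall>X\<in>sections A Hor. \<forall>V\<in>sections A Ver. T V (endo_apply I X) = 0)) \<and>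
         ((\<forall>X\<in>sections A Hor. \<forall>V\<in>sections A Ver. T V (endo_apply I X) = 0) \<longleftrightarrow>
            (\<forall>X\<in>sections A Hor. \<forall>V\<in>sections A Ver. T V (endo_apply K X) = 0)) \<and>
         ((\<forall>X\<in>sections A Hor. \<forall>V\<in>sections A Ver. T V (endo_apply K X) = 0) \<longleftrightarrow>
            (\<forall>X\<in>sections A Hor. \<forall>V\<in>sections A Ver. T V (endo_apply J X) = 0))"
proof -
  have g: "riemannian_metric A gM" and D: "affine_connection A D"
    using assms(1) by (auto simp: hyperkaehler_manifold_def riemannian_manifold_def levi_civita_def)
  have F: "riemannian_submersion A gM B gN F"
    and IV: "\<And>p. I p ` Ver p = Hor p" and JV: "\<And>p. J p ` Ver p = Ver p"
    and KV: "\<And>p. K p ` Ver p = Hor p"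
    using assms(3) by (auto simp: h_Lagrangian_submersion_def Ver_def Hor_def)
  have R: "smooth_endo_field A R" "parallel_endo A D R"
      "\<And>p u. u \<in> tangent_space A p \<Longrightarrow> R p (R p u) = - u" if "R \<in> {I, J, K}" for R
    using assms(1) that unfolding hyperkaehler_manifold_def by blast+
  have Ver: "\<And>p. subspace (Ver p)" "\<And>p. Ver p \<subseteq> tangent_space A p"
    unfolding Ver_def by (rule subspace_ker_diff ker_diff_subset)+
  have Hor: "\<And>p. subspace (Hor p)" "\<And>p. Hor p \<subseteq> tangent_space A p"
    unfolding Hor_def by (rule subspace_orth_distribution[OF g Ver(2)] orth_distribution_subset)+
  have HV: "R p ` Hor p = Ver p" if "R \<in> {I, K}" for R p
    using endo_image_swap[of A R Ver Hor p] R[of R] Ver IV KV that by blast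
  \<comment> \<open>The hypothesis on \<open>J\<close> concerns vertical vectors only. Horizontal
    ones have the form \<open>I p v\<close>, and \<open>J I = - K\<close> sends them to
    \<open>K p (- v)\<close>, which is horizontal and exhausts \<open>Hor p\<close>.\<close>
  have JH: "J p ` Hor p = Hor p" for p
  proof -
    have "J p (I p v) = K p (- v)" if "v \<in> Ver p" for v
    proof -
      have v: "v \<in> tangent_space A p"
        using Ver(2) that by blast
      \<comment> \<open>Fibrewise linearity is stated through sums and scalar multiples, so negation
        enters as the scalar \<open>- 1\<close>.\<close>
      have "K p ((- 1) *\<^sub>R v) = (- 1) *\<^sub>R K p v"
        using R(1)[of K] v unfolding smooth_endo_field_def by blast
      moreover have "J p (I p v) = - K p v"
        using assms(1) v unfolding hyperkaehler_manifold_def by blast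
      ultimately show ?thesis
        by simp
    qed
    then have "J p ` I p ` Ver p = K p ` uminus ` Ver p"
      by (simp add: image_image)
    also have "uminus ` Ver p = Ver p"
      using subspace_neg[OF Ver(1)] by (force simp: image_iff)
    finally show ?thesis
      by (simp add: IV KV)
  qed
  have I_sections: "endo_apply I ` sections A Ver = sections A Hor"
    using R[of I] Ver IV by (intro endo_apply_image_sections) auto
  have J_sections: "endo_apply J ` sections A Hor = sections A Hor"
    using R[of J] Hor JH by (intro endo_apply_image_sections) auto
  have IK_sections: "endo_apply R ` sections A Hor = sections A Ver" if "R \<in> {I, K}" for R
    using R[of R] Hor HV[OF that] that by (intro endo_apply_image_sections) auto

  \<comment> \<open>The differentiated field is quantified first, matching the order of
    \<open>X\<close> and \<open>V\<close> in the other conditions.\<close>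
  have a: "totally_geodesic_foliation A D Ver \<longleftrightarrow>
      (\<forall>W\<in>sections A Ver. \<forall>V\<in>sections A Ver. D V W \<in> sections A Ver)"
    by (auto simp: totally_geodesic_foliation_def)
  have bc: "(\<forall>X\<in>sections A Hor. \<forall>V\<in>sections A Ver. T V (endo_apply R X) = 0) \<longleftrightarrow>
      totally_geodesic_foliation A D Ver" if "R \<in> {I, K}" for R
  proof -
    \<comment> \<open>Substitute \<open>W = endo_apply R X\<close>, which runs through all vertical
      fields.\<close>
    have "(\<forall>X\<in>sections A Hor. \<forall>V\<in>sections A Ver. T V (endo_apply R X) = 0) \<longleftrightarrow>
        (\<forall>W\<in>endo_apply R ` sections A Hor. \<forall>V\<in>sections A Ver. T V W = 0)"
      by simp
    also have "\<dots> \<longleftrightarrow> totally_geodesic_foliation A D Ver"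
      unfolding IK_sections[OF that] a
      using oneill_T_vertical_eq_zero_iff[OF g F D] by (simp add: T_def Ver_def)
    finally show ?thesis .
  qed
  \<comment> \<open>Parallelism moves \<open>I\<close> outside the derivative; as \<open>I\<close>
    takes vertical values exactly to horizontal ones, both directions follow.\<close>
  have "D V (endo_apply I W) \<in> sections A Hor \<longleftrightarrow> D V W \<in> sections A Ver"
    if "V \<in> sections A Ver" "W \<in> sections A Ver" for V W
  proof -
    have VW: "V \<in> vector_fields A" "W \<in> vector_fields A"
      using that by (auto simp: sections_def)
    then have "D V (endo_apply I W) - endo_apply I (D V W) = 0"
      using R(2)[of I] unfolding parallel_endo_def by blast
    moreover have "D V W \<in> vector_fields A"
      using D VW unfolding affine_connection_def by blast
    ultimately show ?thesis
      using endo_apply_in_sections_iff[of A I Ver Hor "D V W"] R[of I] Ver IV by simp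
  qed
  \<comment> \<open>Every horizontal field is \<open>endo_apply I W\<close> with \<open>W\<close>
    vertical, so \<open>X\<close> may replace it.\<close>
  then have "totally_geodesic_foliation A D Ver \<longleftrightarrow>
      (\<forall>X\<in>sections A Hor. \<forall>V\<in>sections A Ver. D V X \<in> sections A Hor)"
    by (simp add: a flip: I_sections)
  also have "\<dots> \<longleftrightarrow> (\<forall>X\<in>sections A Hor. \<forall>V\<in>sections A Ver. T V X = 0)"
    using oneill_T_horizontal_eq_zero_iff[OF g F D] by (simp add: T_def Hor_def Ver_def)
  also have "\<dots> \<longleftrightarrow> (\<forall>X\<in>endo_apply J ` sections A Hor. \<forall>V\<in>sections A Ver. T V X = 0)"
    by (simp only: J_sections)
  also have "\<dots> \<longleftrightarrow> (\<forall>X\<in>sections A Hor. \<forall>V\<in>sections A Ver. T V (endo_apply J X) = 0)"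
    by simp
  finally show ?thesis
    using bc[of I] bc[of K] by blast
qed

end
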